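(* Let $\lambda>0$. The class $\Omega_{\mathcal{H}}^0(\lambda)$ is closed under convex combination: if $n\in\mathbb{N}$, $f_1,\dots,f_n\in\Omega_{\mathcal{H}}^0(\lambda)$, and $t_1,\dots,t_n\in[0,1]$ with $\sum_{k=1}^nt_k=1$, then $\sum_{k=1}^nt_kf_k\in\Omega_{\mathcal{H}}^0(\lambda)$.
   Context: $\mathbb{D}=\{z\in\mathbb{C}:|z|<1\}$. $\mathcal{H}^0$ is the class of complex-valued harmonic functions $f=h+\overline{g}$ on $\mathbb{D}$, where $h,g$ are analytic on $\mathbb{D}$ with $h(z)=z+\sum_{n\ge2}a_nz^n$ and $g(z)=\sum_{n\ge2}b_nz^n$. For $\lambda>0$, $\Omega_{\mathcal{H}}^0(\lambda)$ is the set of $f=h+\overline{g}\in\mathcal{H}^0$ such that $|h(z)-zh'(z)|<\lambda-|g(z)-zg'(z)|$ for all $z\in\mathbb{D}$. *)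

theory Defs
  imports "HOL-Analysis.Analysis"
begin

text \<open>
  Functions on the unit disc are rendered as total functions of type \<^typ>\<open>complex \<Rightarrow> complex\<close>
  whose values outside the disc are irrelevant.  A function of the form \<open>h + cnj g\<close> with
  \<open>h\<close>, \<open>g\<close> analytic is automatically harmonic, so harmonicity is not a separate clause.
  On the disc, \<open>h\<close> and \<open>g\<close> are determined by \<open>f\<close>: two decompositions differ by a function
  that is both analytic and antianalytic, hence constant, and \<open>g 0 = 0\<close> makes it zero.
  Quantifying existentially over the decomposition is therefore unambiguous.
\<close>

definition canonical_decomp ::
  "(complex \<Rightarrow> complex) \<Rightarrow> (complex \<Rightarrow> complex) \<Rightarrow> (complex \<Rightarrow> complex) \<Rightarrow> bool" where
  "canonical_decomp f h g \<longleftrightarrow>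
     h analytic_on ball 0 1 \<and> g analytic_on ball 0 1 \<and>
     (\<exists>a :: nat \<Rightarrow> complex. \<forall>z\<in>ball 0 1. (\<lambda>n. a (n + 2) * z ^ (n + 2)) sums (h z - z)) \<and>
     (\<exists>b :: nat \<Rightarrow> complex. \<forall>z\<in>ball 0 1. (\<lambda>n. b (n + 2) * z ^ (n + 2)) sums g z) \<and>
     (\<forall>z\<in>ball 0 1. f z = h z + cnj (g z))"

definition harmonic_class0 :: "(complex \<Rightarrow> complex) set" where
  "harmonic_class0 = {f. \<exists>h g. canonical_decomp f h g}"

definition Omega_H0 :: "real \<Rightarrow> (complex \<Rightarrow> complex) set" where
  "Omega_H0 lam = {f \<in> harmonic_class0. \<exists>h g. canonical_decomp f h g \<and>
     (\<forall>z\<in>ball 0 1. cmod (h z - z * deriv h z) < lam - cmod (g z - z * deriv g z))}"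

end

theory Submission
  imports Defs
begin

text \<open>Moving the \<open>g\<close> term to the left, the defining inequality says that |h(z) -
  z h'(z)| + |g(z) - z g'(z)| < \<open>lam\<close>. The map sending h to h - z h' is linear, so at
  each z the left side is a seminorm of the pair (h, g), and its strict sublevel sets are convex.
  Real weights commute with conjugation, so the combined pair decomposes the combined function
  (\<open>canonical_decomp_convex_sum\<close>). The bound follows from the triangle inequality
  (\<open>norm_weighted_sum_minus_deriv_le\<close>) and from the fact that a weighted mean of
  numbers below \<open>lam\<close> is below \<open>lam\<close>
  (\<open>convex_sum_less\<close>).\<close>

lemma deriv_weighted_sum:
  fixes h :: "'i \<Rightarrow> complex \<Rightarrow> complex"
  assumes "\<And>k. k \<in> K \<Longrightarrow> h k field_differentiable at z"
  shows "deriv (\<lambda>z. \<Sum>k\<in>K. c k * h k z) z = (\<Sum>k\<in>K. c k * deriv (h k) z)"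
  by (intro DERIV_imp_deriv DERIV_sum DERIV_cmult)
     (simp add: assms field_differentiable_derivI)

text \<open>Power series combine coefficientwise, and \<open>cnj\<close> fixes the real weights.
  That the weights sum to 1 is what keeps the linear term of the analytic part equal to z.\<close>

lemma canonical_decomp_convex_sum:
  fixes t :: "'i \<Rightarrow> real"
  assumes decomp: "\<And>k. k \<in> K \<Longrightarrow> canonical_decomp (f k) (h k) (g k)"
    and t: "(\<Sum>k\<in>K. t k) = 1"
  shows "canonical_decomp (\<lambda>z. \<Sum>k\<in>K. complex_of_real (t k) * f k z)
    (\<lambda>z. \<Sum>k\<in>K. complex_of_real (t k) * h k z) (\<lambda>z. \<Sum>k\<in>K. complex_of_real (t k) * g k z)"
proof -
  let ?H = "\<lambda>z. \<Sum>k\<in>K. complex_of_real (t k) * h k z"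
  let ?G = "\<lambda>z. \<Sum>k\<in>K. complex_of_real (t k) * g k z"
  have "\<forall>k\<in>K. \<exists>a :: nat \<Rightarrow> complex. \<forall>z\<in>ball 0 1. (\<lambda>n. a (n + 2) * z ^ (n + 2)) sums (h k z - z)"
    using decomp by (auto simp: canonical_decomp_def)
  then obtain a :: "'i \<Rightarrow> nat \<Rightarrow> complex" where
    a: "\<And>k z. k \<in> K \<Longrightarrow> z \<in> ball 0 1 \<Longrightarrow> (\<lambda>n. a k (n + 2) * z ^ (n + 2)) sums (h k z - z)"
    by metis
  have "\<forall>k\<in>K. \<exists>b :: nat \<Rightarrow> complex. \<forall>z\<in>ball 0 1. (\<lambda>n. b (n + 2) * z ^ (n + 2)) sums g k z"
    using decomp by (auto simp: canonical_decomp_def)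
  then obtain b :: "'i \<Rightarrow> nat \<Rightarrow> complex" where
    b: "\<And>k z. k \<in> K \<Longrightarrow> z \<in> ball 0 1 \<Longrightarrow> (\<lambda>n. b k (n + 2) * z ^ (n + 2)) sums g k z"
    by metis
  have t': "(\<Sum>k\<in>K. complex_of_real (t k)) = 1"
    using t by (metis of_real_1 of_real_sum)
  have "(\<lambda>n. (\<Sum>k\<in>K. t k * a k (n + 2)) * z ^ (n + 2)) sums (?H z - z)" if "z \<in> ball 0 1" for z
  proof -
    have "(\<lambda>n. \<Sum>k\<in>K. t k * (a k (n + 2) * z ^ (n + 2))) sums (\<Sum>k\<in>K. t k * (h k z - z))"
      using a that by (intro sums_sum sums_mult)
    \<comment> \<open>The subtracted terms collect to z times the total weight, that is, to
      z.\<close>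
    moreover have "(\<Sum>k\<in>K. t k * (h k z - z)) = ?H z - z"
      using t' by (simp add: right_diff_distrib sum_subtractf flip: sum_distrib_right)
    ultimately show ?thesis
      by (simp only: sum_distrib_right mult.assoc)
  qed
  moreover have "(\<lambda>n. (\<Sum>k\<in>K. t k * b k (n + 2)) * z ^ (n + 2)) sums ?G z"
    if "z \<in> ball 0 1" for z
  proof -
    have "(\<lambda>n. \<Sum>k\<in>K. t k * (b k (n + 2) * z ^ (n + 2))) sums ?G z"
      using b that by (intro sums_sum sums_mult)
    then show ?thesis
      by (simp only: sum_distrib_right mult.assoc)
  qed
  moreover have "?H analytic_on ball 0 1" "?G analytic_on ball 0 1"
    using decomp by (auto simp: canonical_decomp_def intro!: analytic_intros)
  moreover have "(\<Sum>k\<in>K. complex_of_real (t k) * f k z) = ?H z + cnj (?G z)"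
    if "z \<in> ball 0 1" for z
    using decomp that by (simp add: canonical_decomp_def distrib_left sum.distrib)
  ultimately show ?thesis
    unfolding canonical_decomp_def
    by (intro conjI ballI exI[of _ "\<lambda>n. \<Sum>k\<in>K. t k * a k n"]
        exI[of _ "\<lambda>n. \<Sum>k\<in>K. t k * b k n"])
qed

text \<open>Some weights may vanish, so termwise comparison with \<open>t k * c\<close> is only
  weak. Weights summing to 1 cannot all be zero, and an index of nonzero weight makes the comparison
  of the sums strict. This also rules out an empty \<open>K\<close>.\<close>

lemma convex_sum_less:
  fixes t x :: "'i \<Rightarrow> real"
  assumes K: "finite K" and t: "\<And>k. k \<in> K \<Longrightarrow> t k \<ge> 0" "(\<Sum>k\<in>K. t k) = 1"
    and x: "\<And>k. k \<in> K \<Longrightarrow> x k < c"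
  shows "(\<Sum>k\<in>K. t k * x k) < c"
proof -
  obtain j where "j \<in> K" "t j \<noteq> 0"
    using t(2) by (metis sum.neutral zero_neq_one)
  then have "\<exists>j\<in>K. t j * x j < t j * c"
    using t(1)[of j] x[of j] by (intro bexI[of _ j]) auto
  then have "(\<Sum>k\<in>K. t k * x k) < (\<Sum>k\<in>K. t k * c)"
    using K t(1) x by (intro sum_strict_mono_ex1) (auto intro!: mult_left_mono dest: less_imp_le)
  then show ?thesis
    using t(2) by (simp flip: sum_distrib_right)
qed

text \<open>By linearity, the expression for \<open>H\<close> is the weighted sum of those for the
  \<open>h k\<close>; the triangle inequality then applies, and nonnegative weights come out of the
  norm unchanged.\<close>

lemma norm_weighted_sum_minus_deriv_le:
  fixes h :: "'i \<Rightarrow> complex \<Rightarrow> complex" and t :: "'i \<Rightarrow> real"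
  assumes h: "\<And>k. k \<in> K \<Longrightarrow> h k field_differentiable at z"
    and t: "\<And>k. k \<in> K \<Longrightarrow> t k \<ge> 0"
  defines "H \<equiv> \<lambda>z. \<Sum>k\<in>K. complex_of_real (t k) * h k z"
  shows "cmod (H z - z * deriv H z) \<le> (\<Sum>k\<in>K. t k * cmod (h k z - z * deriv (h k) z))"
proof -
  have "H z - z * deriv H z = (\<Sum>k\<in>K. t k * (h k z - z * deriv (h k) z))"
    using h
    by (simp add: H_def deriv_weighted_sum sum_distrib_left algebra_simps sum_subtractf)
  also have "cmod \<dots> \<le> (\<Sum>k\<in>K. cmod (t k * (h k z - z * deriv (h k) z)))"
    by (rule norm_sum)
  also have "\<dots> = (\<Sum>k\<in>K. t k * cmod (h k z - z * deriv (h k) z))"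
    using t by (simp add: norm_mult)
  finally show ?thesis .
qed

theorem theorem2p5:
  fixes lam :: real and n :: nat
    and f :: "nat \<Rightarrow> complex \<Rightarrow> complex" and t :: "nat \<Rightarrow> real"
  assumes "lam > 0"
    and "\<And>k. k \<in> {1..n} \<Longrightarrow> f k \<in> Omega_H0 lam"
    and "\<And>k. k \<in> {1..n} \<Longrightarrow> t k \<in> {0..1}"
    and "(\<Sum>k=1..n. t k) = 1"
  shows "(\<lambda>z. \<Sum>k=1..n. complex_of_real (t k) * f k z) \<in> Omega_H0 lam"
proof -
  \<comment> \<open>The decompositions are those that carry the bound, not arbitrary ones from
    \<open>harmonic_class0\<close>.\<close>
  have "\<forall>k\<in>{1..n}. \<exists>h g. canonical_decomp (f k) h g \<and>
      (\<forall>z\<in>ball 0 1. cmod (h z - z * deriv h z) < lam - cmod (g z - z * deriv g z))"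
    using assms(2) unfolding Omega_H0_def by blast
  then obtain h g where
    decomp: "\<And>k. k \<in> {1..n} \<Longrightarrow> canonical_decomp (f k) (h k) (g k)" and
    bound: "\<And>k z. k \<in> {1..n} \<Longrightarrow> z \<in> ball 0 1 \<Longrightarrow>
      cmod (h k z - z * deriv (h k) z) < lam - cmod (g k z - z * deriv (g k) z)"
    by metis
  define H where "H = (\<lambda>z. \<Sum>k=1..n. complex_of_real (t k) * h k z)"
  define G where "G = (\<lambda>z. \<Sum>k=1..n. complex_of_real (t k) * g k z)"
  have t: "\<And>k. k \<in> {1..n} \<Longrightarrow> t k \<ge> 0"
    using assms(3) by simp
  have "canonical_decomp (\<lambda>z. \<Sum>k=1..n. complex_of_real (t k) * f k z) H G"
    unfolding H_def G_def using decomp assms(4) by (rule canonical_decomp_convex_sum)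
  moreover have "cmod (H z - z * deriv H z) < lam - cmod (G z - z * deriv G z)"
    if z: "z \<in> ball 0 1" for z
  proof -
    \<comment> \<open>Analyticity on the disc makes every summand differentiable at z, as passing
      \<open>deriv\<close> through the sums requires.\<close>
    have diff: "h k field_differentiable at z" "g k field_differentiable at z"
      if "k \<in> {1..n}" for k
      using decomp[OF that] z
      by (auto simp: canonical_decomp_def analytic_on_imp_differentiable_at)
    \<comment> \<open>Both norms are estimated together, so that the result is one weighted mean of
      quantities that \<open>bound\<close> places below \<open>lam\<close>.\<close>
    have "cmod (H z - z * deriv H z) + cmod (G z - z * deriv G z) \<le>
      (\<Sum>k=1..n. t k * cmod (h k z - z * deriv (h k) z)) +
      (\<Sum>k=1..n. t k * cmod (g k z - z * deriv (g k) z))"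
      unfolding H_def G_def
      by (intro add_mono norm_weighted_sum_minus_deriv_le diff t)
    also have "\<dots> = (\<Sum>k=1..n. t k *
        (cmod (h k z - z * deriv (h k) z) + cmod (g k z - z * deriv (g k) z)))"
      by (simp add: distrib_left sum.distrib)
    also have "\<dots> < lam"
      using bound[OF _ z] t assms(4) by (intro convex_sum_less) (auto simp: less_diff_eq)
    finally show ?thesis
      by simp
  qed
  \<comment> \<open>The same pair \<open>H\<close>, \<open>G\<close> witnesses both membership in
    \<open>harmonic_class0\<close> and the inequality.\<close>
  ultimately show ?thesis
    unfolding Omega_H0_def harmonic_class0_def by blast
qed

end
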